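(* Let $\Omega\subseteq\mathbb{R}^d$ be open with $\mu(\Omega)<\infty$, let $p(\cdot)\in\mathcal{P}$ with $p_+<\infty$, and suppose that there exists $x_0\in\Omega$ such that $p(x_0)=p_-$ and $p(\cdot)\in LH_0\{x_0\}$. 1. If $p_->1$, then $L_{p(\cdot)}(\Omega)\not\hookrightarrow L_{p_-,s}(\Omega)$ for all $0<s<p_-$. 2. If $1<q\le\infty$, then $L_{p(\cdot),q}(\Omega)\not\hookrightarrow L_{p_-,u}(\Omega)$ for all $0<u<q$.
   Context: $\mu$ is Lebesgue measure on $\Omega$; $\chi_A$ is the characteristic function of $A$. $X_1\hookrightarrow X_2$ means $X_1\subseteq X_2$ with continuous inclusion, i.e. $\|f\|_{X_2}\le c\|f\|_{X_1}$ for some $c>0$ and all $f\in X_1$; $\not\hookrightarrow$ is its negation. For a measurable $p(\cdot):\Omega\to(0,\infty)$ put $p_-=\operatorname{ess\,inf}_{x\in\Omega}p(x)$, $p_+=\operatorname{ess\,sup}_{x\in\Omega}p(x)$. $\mathcal{P}$ is the set of such functions with $p_->0$ (exponent functions). Log-Hölder continuity: $r(\cdot)\in LH_0\{x_0\}$ (locally log-Hölder continuous at $x_0\in\Omega$) if there is $C_0>0$ with $|r(x)-r(x_0)|\le\frac{C_0}{-\log(|x-x_0|)}$ for all $x\in\Omega$ with $|x-x_0|<1/2$. Variable Lebesgue space $L_{p(\cdot)}(\Omega)$: with $\varrho_{p(\cdot)}(f)=\int_\Omega|f(x)|^{p(x)}\,dx$, it consists of the measurable $f$ with $\varrho_{p(\cdot)}(f/\lambda)<\infty$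 for some $\lambda>0$, with quasi-norm $\|f\|_{p(\cdot)}=\inf\{\lambda>0:\varrho_{p(\cdot)}(f/\lambda)\le1\}$. Variable Lorentz space $L_{p(\cdot),q}(\Omega)$: the measurable $f:\Omega\to\mathbb{R}$ with finite quasi-norm $$\|f\|_{L_{p(\cdot),q}}=\left(\int_0^\infty u^q\,\|\chi_{\{|f|>u\}}\|_{p(\cdot)}^q\,\frac{du}{u}\right)^{1/q}\ (0<q<\infty),\qquad \|f\|_{L_{p(\cdot),\infty}}=\sup_{u>0}u\,\|\chi_{\{|f|>u\}}\|_{p(\cdot)}.$$ Classical Lorentz space $L_{r,s}(\Omega)$ ($0<r<\infty$): quasi-norm $\|f\|_{L_{r,s}}=\left(\int_0^\infty(t^{1/r}f^*(t))^s\frac{dt}{t}\right)^{1/s}$ for $0<s<\infty$ and $\sup_{t>0}t^{1/r}f^*(t)$ for $s=\infty$, where $f^*(t)=\inf\{\sigma>0:\mu(\{|f|>\sigma\})\le t\}$. *)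

theory Defs
  imports "HOL-Probability.Essential_Supremum"
begin

text \<open>Functions on \<open>\<Omega>\<close> are total functions on the ambient Euclidean space of which only the
  values on \<open>\<Omega>\<close> matter; measurability is Lebesgue measurability on \<open>\<Omega>\<close>. Summability exponents
  that may be infinite have type \<^typ>\<open>ereal\<close>.\<close>

section \<open>Exponent functions\<close>

text \<open>The dual of the library's \<^const>\<open>esssup\<close>.\<close>

definition essinf :: "'a measure \<Rightarrow> ('a \<Rightarrow> ereal) \<Rightarrow> ereal" where
  "essinf M f = Sup {z. AE x in M. z \<le> f x}"

definition p_minus :: "'a::euclidean_space set \<Rightarrow> ('a \<Rightarrow> real) \<Rightarrow> ereal" where
  "p_minus \<Omega> p = essinf (lebesgue_on \<Omega>) (\<lambda>x. ereal (p x))"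

definition p_plus :: "'a::euclidean_space set \<Rightarrow> ('a \<Rightarrow> real) \<Rightarrow> ereal" where
  "p_plus \<Omega> p = esssup (lebesgue_on \<Omega>) (\<lambda>x. ereal (p x))"

definition exponent_functions :: "'a::euclidean_space set \<Rightarrow> ('a \<Rightarrow> real) set" where
  "exponent_functions \<Omega> =
     {p \<in> borel_measurable (lebesgue_on \<Omega>). (\<forall>x\<in>\<Omega>. 0 < p x) \<and> 0 < p_minus \<Omega> p}"

text \<open>At \<open>x = x0\<close> the bound reads \<open>0 \<le> 0\<close> (as \<open>ln 0 = 0\<close> and \<open>C0 / 0 = 0\<close>), so that point imposes
  no condition, in agreement with the convention \<open>C0 / \<infinity> = 0\<close>.\<close>

definition log_hoelder_at :: "'a::euclidean_space set \<Rightarrow> 'a \<Rightarrow> ('a \<Rightarrow> real) set" where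
  "log_hoelder_at \<Omega> x0 =
     {r. \<exists>C0>0. \<forall>x\<in>\<Omega>. norm (x - x0) < 1/2 \<longrightarrow> \<bar>r x - r x0\<bar> \<le> C0 / (- ln (norm (x - x0)))}"

section \<open>Quasi-normed function spaces\<close>

text \<open>A carrier together with a quasi-norm. The quasi-norms take values in \<^typ>\<open>ennreal\<close>, so that
  the value \<open>\<infinity>\<close> is available outside the carrier.\<close>

type_synonym 'a qn_space = "('a \<Rightarrow> real) set \<times> (('a \<Rightarrow> real) \<Rightarrow> ennreal)"

definition cont_embedded :: "'a qn_space \<Rightarrow> 'a qn_space \<Rightarrow> bool"  (infix "\<hookrightarrow>" 50) where
  "X \<hookrightarrow> Y \<longleftrightarrow> fst X \<subseteq> fst Y \<and> (\<exists>c>0. \<forall>f\<in>fst X. snd Y f \<le> ennreal c * snd X f)"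

abbreviation not_cont_embedded :: "'a qn_space \<Rightarrow> 'a qn_space \<Rightarrow> bool"  (infix "\<not>\<hookrightarrow>" 50) where
  "X \<not>\<hookrightarrow> Y \<equiv> \<not> (X \<hookrightarrow> Y)"

text \<open>Extended nonnegative powers; only used for exponents \<open>a > 0\<close>.\<close>

definition ennpowr :: "ennreal \<Rightarrow> real \<Rightarrow> ennreal"  (infixr "epowr" 80) where
  "x epowr a = (if x = \<infinity> then \<infinity> else ennreal (enn2real x powr a))"

section \<open>Variable Lebesgue spaces\<close>

definition modular :: "'a::euclidean_space set \<Rightarrow> ('a \<Rightarrow> real) \<Rightarrow> ('a \<Rightarrow> real) \<Rightarrow> ennreal" where
  "modular \<Omega> p f = (\<integral>\<^sup>+x. ennreal (\<bar>f x\<bar> powr p x) \<partial>lebesgue_on \<Omega>)"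

definition var_Lebesgue_norm :: "'a::euclidean_space set \<Rightarrow> ('a \<Rightarrow> real) \<Rightarrow> ('a \<Rightarrow> real) \<Rightarrow> ennreal"
  where
  "var_Lebesgue_norm \<Omega> p f = Inf (ennreal ` {l. 0 < l \<and> modular \<Omega> p (\<lambda>x. f x / l) \<le> 1})"

definition var_Lebesgue :: "'a::euclidean_space set \<Rightarrow> ('a \<Rightarrow> real) \<Rightarrow> 'a qn_space" where
  "var_Lebesgue \<Omega> p =
     ({f \<in> borel_measurable (lebesgue_on \<Omega>). \<exists>l>0. modular \<Omega> p (\<lambda>x. f x / l) < \<infinity>},
      var_Lebesgue_norm \<Omega> p)"

section \<open>Variable Lorentz spaces\<close>

definition superlevel_norm ::
  "'a::euclidean_space set \<Rightarrow> ('a \<Rightarrow> real) \<Rightarrow> ('a \<Rightarrow> real) \<Rightarrow> real \<Rightarrow> ennreal" where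
  "superlevel_norm \<Omega> p f u = var_Lebesgue_norm \<Omega> p (indicat_real {x \<in> \<Omega>. u < \<bar>f x\<bar>})"

definition var_Lorentz_norm ::
  "'a::euclidean_space set \<Rightarrow> ('a \<Rightarrow> real) \<Rightarrow> ereal \<Rightarrow> ('a \<Rightarrow> real) \<Rightarrow> ennreal" where
  "var_Lorentz_norm \<Omega> p q f =
     (if q = \<infinity> then SUP u\<in>{0<..}. ennreal u * superlevel_norm \<Omega> p f u
      else let q' = real_of_ereal q in
        (\<integral>\<^sup>+u\<in>{0<..}. (ennreal (u powr q') * superlevel_norm \<Omega> p f u epowr q' / ennreal u) \<partial>lborel)
          epowr (1 / q'))"

definition var_Lorentz :: "'a::euclidean_space set \<Rightarrow> ('a \<Rightarrow> real) \<Rightarrow> ereal \<Rightarrow> 'a qn_space" where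
  "var_Lorentz \<Omega> p q =
     ({f \<in> borel_measurable (lebesgue_on \<Omega>). var_Lorentz_norm \<Omega> p q f < \<infinity>},
      var_Lorentz_norm \<Omega> p q)"

section \<open>Classical Lorentz spaces\<close>

text \<open>The infimum is taken in \<^typ>\<open>ennreal\<close>, hence is \<open>\<infinity>\<close> if no level \<open>\<sigma>\<close> qualifies.\<close>

definition decr_rearr :: "'a::euclidean_space set \<Rightarrow> ('a \<Rightarrow> real) \<Rightarrow> real \<Rightarrow> ennreal" where
  "decr_rearr \<Omega> f t =
     Inf (ennreal ` {\<sigma>. 0 < \<sigma> \<and> emeasure lebesgue {x \<in> \<Omega>. \<sigma> < \<bar>f x\<bar>} \<le> ennreal t})"

definition Lorentz_norm ::
  "'a::euclidean_space set \<Rightarrow> real \<Rightarrow> ereal \<Rightarrow> ('a \<Rightarrow> real) \<Rightarrow> ennreal" where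
  "Lorentz_norm \<Omega> r s f =
     (if s = \<infinity> then SUP t\<in>{0<..}. ennreal (t powr (1 / r)) * decr_rearr \<Omega> f t
      else let s' = real_of_ereal s in
        (\<integral>\<^sup>+t\<in>{0<..}. ((ennreal (t powr (1 / r)) * decr_rearr \<Omega> f t) epowr s' / ennreal t) \<partial>lborel)
          epowr (1 / s'))"

definition Lorentz :: "'a::euclidean_space set \<Rightarrow> real \<Rightarrow> ereal \<Rightarrow> 'a qn_space" where
  "Lorentz \<Omega> r s =
     ({f \<in> borel_measurable (lebesgue_on \<Omega>). Lorentz_norm \<Omega> r s f < \<infinity>}, Lorentz_norm \<Omega> r s)"

end

theory Submission
  imports Defs "HOL-Real_Asymp.Real_Asymp"
begin

text \<open>Write \<open>P = p x0\<close> for the minimal exponent and \<open>n\<close> for the dimension, and test the embeddings on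
  \<open>max (dist x0 x) e powr (- (n / P))\<close>, cut off outside a small ball around \<open>x0\<close>, as \<open>e\<close> tends to
  0. Log-Hoelder continuity at \<open>x0\<close> says that \<open>h powr (- (n / P) * p x)\<close> is at most a constant times
  \<open>h powr (- n)\<close> whenever \<open>dist x0 x \<le> h\<close>, so that near \<open>x0\<close> the variable exponent may be replaced by
  \<open>P\<close>. Up to constants the norm of the test function is then \<open>ln (1 / e)\<close> to the power \<open>1 / P\<close> in the
  variable Lebesgue space and \<open>1 / q\<close> in the variable Lorentz space, but \<open>1 / s\<close> in the classical
  Lorentz space with second index \<open>s\<close>; hence no embedding constant exists when \<open>s\<close> is smaller than
  \<open>P\<close> or \<open>q\<close>.\<close>

section \<open>Essential infimum, extended powers, elementary norm facts\<close>

text \<open>Each \<open>a - inverse (real (Suc n))\<close> lies strictly below the defining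
  supremum, so it is a lower bound almost everywhere. Countably many null sets are discarded at once
  before passing to the limit.\<close>

lemma AE_essinf_le:
  assumes "essinf M f = ereal a"
  shows "AE x in M. ereal a \<le> f x"
proof -
  have "AE x in M. ereal (a - inverse (real (Suc n))) \<le> f x" for n
  proof -
    have "ereal (a - inverse (real (Suc n))) < Sup {z. AE x in M. z \<le> f x}"
      using assms by (simp add: essinf_def)
    then obtain z where z: "AE x in M. z \<le> f x" "ereal (a - inverse (real (Suc n))) < z"
      by (auto simp: less_Sup_iff)
    show ?thesis
      using z(1) by eventually_elim (use z(2) in auto)
  qed
  then have "AE x in M. \<forall>n. ereal (a - inverse (real (Suc n))) \<le> f x"
    by (simp add: AE_all_countable)
  then show ?thesis
  proof eventually_elim
    case (elim x)
    have "(\<lambda>n. a - inverse (real (Suc n))) \<longlonglongrightarrow> a - 0"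
      by (intro tendsto_intros LIMSEQ_inverse_real_of_nat)
    then have "(\<lambda>n. ereal (a - inverse (real (Suc n)))) \<longlonglongrightarrow> ereal a"
      by simp
    then show ?case
      by (rule LIMSEQ_le_const2) (use elim in auto)
  qed
qed

lemma epowr_mono:
  assumes "x \<le> y" "0 < a"
  shows "x epowr a \<le> y epowr a"
proof (cases "y = \<infinity>")
  case False
  with assms have "x \<noteq> \<infinity>" by (auto simp: top_unique)
  with False assms show ?thesis
    by (auto simp: ennpowr_def intro!: ennreal_leI powr_mono2 enn2real_mono simp: less_top)
qed (simp add: ennpowr_def)

lemma epowr_ennreal: "0 \<le> x \<Longrightarrow> ennreal x epowr a = ennreal (x powr a)"
  by (simp add: ennpowr_def)

lemma nn_integral_inverse_Icc:
  assumes "0 < a" "a \<le> b"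
  shows "(\<integral>\<^sup>+x\<in>{a..b}. ennreal (1 / x) \<partial>lborel) = ennreal (ln (b / a))"
proof -
  have "(\<integral>\<^sup>+x. ennreal (1 / x) * indicator {a..b} x \<partial>lborel) = ennreal (ln b - ln a)"
    using assms by (intro nn_integral_FTC_Icc) (auto intro!: derivative_eq_intros)
  then show ?thesis
    using assms by (simp add: ln_div)
qed

lemma var_Lebesgue_norm_le:
  assumes "0 < l" "modular \<Omega> p (\<lambda>x. f x / l) \<le> 1"
  shows "var_Lebesgue_norm \<Omega> p f \<le> ennreal l"
  unfolding var_Lebesgue_norm_def using assms by (intro Inf_lower) auto

text \<open>Since \<open>0 powr a = 0\<close>, the modular vanishes and every positive
  \<open>l\<close> is admissible in the infimum.\<close>

lemma var_Lebesgue_norm_zero: "var_Lebesgue_norm \<Omega> p (\<lambda>x. 0) = 0"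
proof -
  have "var_Lebesgue_norm \<Omega> p (\<lambda>x. 0) \<le> 0"
  proof (rule ennreal_le_epsilon)
    fix l :: real
    assume "0 < l"
    then show "var_Lebesgue_norm \<Omega> p (\<lambda>x. 0) \<le> 0 + ennreal l"
      using var_Lebesgue_norm_le[of l \<Omega> p "\<lambda>x. 0"] by (simp add: modular_def)
  qed
  then show ?thesis by simp
qed

section \<open>Growth criterion against continuous embeddings\<close>

text \<open>An embedding constant \<open>c\<close> would keep the unbounded sequence
  \<open>real N powr (\<beta> - \<alpha>)\<close> below a fixed multiple of
  \<open>c\<close>.\<close>

lemma not_cont_embedded_if_growth:
  fixes f :: "nat \<Rightarrow> 'a \<Rightarrow> real"
  assumes "\<alpha> < \<beta>" "0 < a"
    and mem: "\<And>N. 1 \<le> N \<Longrightarrow> f N \<in> fst X"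
    and upper: "\<And>N. 1 \<le> N \<Longrightarrow> snd X (f N) \<le> ennreal (b * real N powr \<alpha>)"
    and lower: "\<And>N. 1 \<le> N \<Longrightarrow> ennreal (a * real N powr \<beta>) \<le> snd Y (f N)"
  shows "X \<not>\<hookrightarrow> Y"
proof
  assume "X \<hookrightarrow> Y"
  then obtain c where c: "c > 0" "\<And>g. g \<in> fst X \<Longrightarrow> snd Y g \<le> ennreal c * snd X g"
    by (auto simp: cont_embedded_def)
  have bound: "real N powr (\<beta> - \<alpha>) \<le> c * \<bar>b\<bar> / a" if "1 \<le> N" for N
  proof -
    have "ennreal (a * real N powr \<beta>) \<le> ennreal c * ennreal (\<bar>b\<bar> * real N powr \<alpha>)"
      using order_trans[OF lower[OF that] c(2)[OF mem[OF that]]]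
      by (rule order_trans)
        (intro mult_left_mono order_trans[OF upper[OF that]] ennreal_leI mult_right_mono, auto)
    then have "a * real N powr \<beta> \<le> c * (\<bar>b\<bar> * real N powr \<alpha>)"
      using c(1) by (simp flip: ennreal_mult)
    then show ?thesis
      using that \<open>0 < a\<close> by (simp add: powr_diff field_simps)
  qed
  have "filterlim (\<lambda>N. real N powr (\<beta> - \<alpha>)) at_top sequentially"
    using assms(1) by real_asymp
  then have "eventually (\<lambda>N. real N powr (\<beta> - \<alpha>) > c * \<bar>b\<bar> / a) sequentially"
    by (auto simp: filterlim_at_top_dense)
  moreover have "eventually (\<lambda>N. 1 \<le> N) sequentially"
    by (rule eventually_ge_at_top)
  ultimately have "eventually (\<lambda>N. False) sequentially"
    by eventually_elim (use bound in force)
  then show False by simp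
qed

section \<open>Local setting at the minimum point\<close>

text \<open>The bound \<open>r < 1 / 2\<close> keeps \<open>- ln (dist x0 x)\<close> positive on the
  punctured ball. The Hoelder estimate is one-sided because \<open>AE_P_le\<close> bounds
  \<open>p\<close> from below. The dimension is a real number so that it can serve as a
  \<open>powr\<close> exponent.\<close>

locale log_hoelder_minimum =
  fixes \<Omega> :: "'a::euclidean_space set" and p :: "'a \<Rightarrow> real" and x0 :: 'a
    and P r C n :: real
  assumes n_eq: "n = real DIM('a)" and open_domain: "open \<Omega>"
    and P_pos: "0 < P" and r_pos: "0 < r" and r_less: "r < 1 / 2" and C_pos: "0 < C"
    and ball_subset: "ball x0 r \<subseteq> \<Omega>"
    and AE_P_le: "AE x in lebesgue_on \<Omega>. P \<le> p x"
    and hoelder: "\<And>x. x \<in> ball x0 r \<Longrightarrow> p x - P \<le> C / (- ln (dist x0 x))"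
begin

abbreviation V :: real where "V \<equiv> unit_ball_vol n"
abbreviation D :: real where "D \<equiv> exp (n * C / P)"
text \<open>\<open>K powr P\<close> dominates \<open>D * V\<close>, the constant left over when the
  modular of a normalised ball indicator is estimated. The maximum with 1 makes \<open>K\<close> an
  admissible divisor in \<open>modular_le\<close>.\<close>

definition K :: real where "K = max 1 ((D * V) powr (1 / P))"

definition truncated_power :: "real \<Rightarrow> 'a \<Rightarrow> real" where
  "truncated_power e x = indicat_real (ball x0 r) x * max (dist x0 x) e powr (- (n / P))"

lemma n_pos: "0 < n" by (simp add: n_eq)

lemma V_pos: "0 < V" using n_pos by simp

lemma V_neq_0: "V \<noteq> 0" using V_pos by (metis less_irrefl)

lemma K_ge_1: "1 \<le> K" by (simp add: K_def)

lemma D_V_le: "D * V \<le> K powr P"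
proof -
  have "D * V = ((D * V) powr (1 / P)) powr P"
    using P_pos V_pos by (simp add: powr_powr)
  also have "\<dots> \<le> K powr P"
    using P_pos by (intro powr_mono2) (auto simp: K_def)
  finally show ?thesis .
qed

lemma emeasure_ball_powr: "0 \<le> h \<Longrightarrow> emeasure lborel (ball x0 h) = ennreal (V * h powr n)"
  by (cases "h = 0") (simp_all add: emeasure_ball powr_realpow n_eq)

text \<open>After taking logarithms the claim reads
  \<open>(n / P) * ((p x - P) * (- ln h)) \<le> n * C / P\<close>. The Hoelder bound at distance
  \<open>dist x0 x\<close> carries over to the larger radius \<open>h\<close> because
  \<open>- ln\<close> decreases.\<close>

lemma powr_hoelder:
  assumes x: "x \<in> ball x0 r" and h: "dist x0 x \<le> h" "0 < h" "h \<le> r"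
  shows "h powr (- (n / P) * p x) \<le> D * h powr (- n)"
proof -
  have ln_h: "0 < - ln h"
    using h r_less by simp
  have "(p x - P) * (- ln h) \<le> C"
  proof (cases "dist x0 x = 0")
    case True
    \<comment> \<open>At the centre the conventions \<open>ln 0 = 0\<close> and
      \<open>C / 0 = 0\<close> turn the Hoelder bound into \<open>p x \<le> P\<close>.\<close>
    then have "p x - P \<le> 0" using hoelder[OF x] by simp
    then have "(p x - P) * (- ln h) \<le> 0"
      using ln_h by (intro mult_nonpos_nonneg) auto
    then show ?thesis using C_pos by linarith
  next
    case False
    then have d: "0 < dist x0 x" by (simp add: order_less_le)
    then have "- ln h \<le> - ln (dist x0 x)"
      using h by simp
    then have "C / (- ln (dist x0 x)) \<le> C / (- ln h)"
      using ln_h C_pos by (intro divide_left_mono mult_pos_pos) linarith+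
    with hoelder[OF x] have "p x - P \<le> C / (- ln h)" by linarith
    then show ?thesis using pos_le_divide_eq[OF ln_h] by blast
  qed
  then have "(n / P) * ((p x - P) * (- ln h)) \<le> (n / P) * C"
    using P_pos n_pos by (intro mult_left_mono) auto
  moreover have "(n / P) * ((p x - P) * (- ln h)) = - (n / P) * p x * ln h + n * ln h"
    using P_pos by (simp add: field_simps)
  ultimately have "- (n / P) * p x * ln h \<le> n * C / P + - n * ln h"
    by simp
  then show ?thesis
    using h(2) by (simp add: powr_def flip: exp_add)
qed

text \<open>Since \<open>P \<le> p x\<close> almost everywhere and \<open>1 \<le> l\<close>,
  \<open>l powr (- p x)\<close> is at most \<open>l powr (- P)\<close>; \<open>powr_hoelder\<close>
  removes the variable exponent from the other factor. The radius \<open>h\<close> may vary with the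
  point: it is constant for indicators and \<open>max (dist x0 x) e\<close> for the test
  function.\<close>

lemma modular_le:
  fixes f h :: "'a \<Rightarrow> real"
  assumes l: "1 \<le> l" and B: "B \<subseteq> ball x0 r"
    and supp: "\<And>x. f x \<noteq> 0 \<Longrightarrow> x \<in> B"
    and f: "\<And>x. x \<in> B \<Longrightarrow> \<bar>f x\<bar> \<le> h x powr (- (n / P))"
    and h: "\<And>x. x \<in> B \<Longrightarrow> dist x0 x \<le> h x \<and> 0 < h x \<and> h x \<le> r"
  shows "modular \<Omega> p (\<lambda>x. f x / l)
    \<le> (\<integral>\<^sup>+x\<in>B. ennreal (l powr (- P) * D * h x powr (- n)) \<partial>lborel)"
proof -
  let ?g = "\<lambda>x. ennreal (l powr (- P) * D * h x powr (- n)) * indicator B x"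
  have "modular \<Omega> p (\<lambda>x. f x / l) \<le> (\<integral>\<^sup>+x. ?g x \<partial>lebesgue_on \<Omega>)"
    unfolding modular_def
  proof (rule nn_integral_mono_AE)
    show "AE x in lebesgue_on \<Omega>. ennreal (\<bar>f x / l\<bar> powr p x) \<le> ?g x"
      using AE_P_le
    proof eventually_elim
      case (elim x)
      show ?case
      proof (cases "f x = 0")
        case False
        then have x: "x \<in> B" by (rule supp)
        have "\<bar>f x / l\<bar> powr p x = \<bar>f x\<bar> powr p x * l powr (- p x)"
          using l by (simp add: powr_divide powr_minus_divide)
        also have "\<dots> \<le> (h x powr (- (n / P))) powr p x * l powr (- P)"
          using elim l P_pos f[OF x] by (intro mult_mono powr_mono2 powr_mono) auto
        also have "\<dots> = h x powr (- (n / P) * p x) * l powr (- P)"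
          by (simp add: powr_powr)
        also have "\<dots> \<le> (D * h x powr (- n)) * l powr (- P)"
          using h[OF x] x B by (intro mult_right_mono powr_hoelder) auto
        finally show ?thesis
          using x by (simp add: mult_ac ennreal_leI)
      qed simp
    qed
  qed
  also have "\<dots> = (\<integral>\<^sup>+x. ?g x * indicator \<Omega> x \<partial>lebesgue)"
    using open_domain by (intro nn_integral_restrict_space) auto
  also have "\<dots> \<le> (\<integral>\<^sup>+x. ?g x \<partial>lebesgue)"
    by (intro nn_integral_mono) (auto simp: indicator_def)
  finally show ?thesis by (simp add: nn_integral_completion)
qed

lemma var_Lebesgue_norm_indicator_le:
  assumes "E \<subseteq> ball x0 h" "0 < h" "h \<le> r"
  shows "var_Lebesgue_norm \<Omega> p (indicat_real E) \<le> ennreal (K * h powr (n / P))"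
proof (rule var_Lebesgue_norm_le)
  show "0 < K * h powr (n / P)" using K_ge_1 assms by simp
  \<comment> \<open>Splitting the normaliser \<open>K * h powr (n / P)\<close> brings the quotient
    into the form required by \<open>modular_le\<close>, with constant radius \<open>h\<close> and
    divisor \<open>K\<close>.\<close>
  let ?f = "\<lambda>x. indicat_real E x * h powr (- (n / P))"
  have "modular \<Omega> p (\<lambda>x. ?f x / K)
      \<le> (\<integral>\<^sup>+x\<in>ball x0 h. ennreal (K powr (- P) * D * h powr (- n)) \<partial>lborel)"
    using assms K_ge_1 by (intro modular_le) (auto simp: indicator_def split: if_splits)
  also have "\<dots> = ennreal (K powr (- P) * D * h powr (- n)) * ennreal (V * h powr n)"
    using assms by (simp add: nn_integral_cmult_indicator emeasure_ball_powr)
  also have "\<dots> = ennreal ((K powr (- P) * D * h powr (- n)) * (V * h powr n))"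
    using V_pos by (intro ennreal_mult[symmetric]) auto
  also have "(K powr (- P) * D * h powr (- n)) * (V * h powr n) = K powr (- P) * (D * V)"
    using assms by (simp add: powr_minus field_simps)
  also have "\<dots> \<le> ennreal (K powr (- P) * K powr P)"
    using D_V_le by (intro ennreal_leI mult_left_mono) auto
  also have "\<dots> = 1"
    using K_ge_1 by (simp add: powr_minus)
  also have "(\<lambda>x. ?f x / K) = (\<lambda>x. indicat_real E x / (K * h powr (n / P)))"
    by (simp add: powr_minus field_simps)
  finally show "modular \<Omega> p (\<lambda>x. indicat_real E x / (K * h powr (n / P))) \<le> 1" .
qed

section \<open>Superlevel sets of the test function and variable Lorentz upper bounds\<close>

lemma truncated_power_measurable: "truncated_power e \<in> borel_measurable (lebesgue_on \<Omega>)"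
proof -
  have "truncated_power e \<in> borel_measurable lborel"
    unfolding truncated_power_def[abs_def]
    by (intro borel_measurable_times borel_measurable_indicator powr_real_measurable
        borel_measurable_max borel_measurable_const borel_measurable_dist) auto
  then show ?thesis
    by (intro measurable_restrict_space1 measurable_completion)
qed

lemma less_powr_iff:
  assumes "0 < u" "0 < m"
  shows "u < m powr (- (n / P)) \<longleftrightarrow> m < u powr (- (P / n))"
proof -
  have "u < m powr (- (n / P)) \<longleftrightarrow> ln u < - (n / P) * ln m"
    using assms ln_less_cancel_iff[of u "m powr (- (n / P))"] by (simp add: ln_powr)
  also have "\<dots> \<longleftrightarrow> ln m < - (P / n) * ln u"
    using P_pos n_pos by (simp add: field_simps) (intro iffI; linarith)
  also have "\<dots> \<longleftrightarrow> m < u powr (- (P / n))"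
    using assms ln_less_cancel_iff[of m "u powr (- (P / n))"] by (simp add: ln_powr)
  finally show ?thesis .
qed

text \<open>For \<open>e < u powr (- (P / n))\<close> this is the ball of radius
  \<open>min r (u powr (- (P / n)))\<close>; otherwise it is empty.\<close>

lemma superlevel_truncated_power:
  assumes "0 < u" "0 < e"
  shows "{x \<in> \<Omega>. u < \<bar>truncated_power e x\<bar>} =
    {x \<in> ball x0 r. max (dist x0 x) e < u powr (- (P / n))}"
proof -
  have "u < max (dist x0 x) e powr (- (n / P)) \<longleftrightarrow> max (dist x0 x) e < u powr (- (P / n))" for x
    using assms by (intro less_powr_iff) auto
  then show ?thesis
    using ball_subset assms by (auto simp: truncated_power_def indicator_def split: if_splits)
qed

text \<open>The superlevel set always lies in the ball of radius \<open>r\<close>. From level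
  \<open>r powr (- (n / P))\<close> on, the radius \<open>u powr (- (P / n))\<close> is the smaller
  one and yields \<open>K / u\<close>. From the maximal value \<open>e powr (- (n / P))\<close> on,
  the set is empty.\<close>

lemma superlevel_norm_le:
  assumes "0 < u" "0 < e"
  shows "superlevel_norm \<Omega> p (truncated_power e) u \<le> ennreal (K * r powr (n / P))"
    and "r powr (- (n / P)) \<le> u \<Longrightarrow>
      superlevel_norm \<Omega> p (truncated_power e) u \<le> ennreal (K / u)"
    and "e powr (- (n / P)) \<le> u \<Longrightarrow> superlevel_norm \<Omega> p (truncated_power e) u = 0"
proof -
  let ?E = "{x \<in> ball x0 r. max (dist x0 x) e < u powr (- (P / n))}"
  have norm_eq: "superlevel_norm \<Omega> p (truncated_power e) u
      = var_Lebesgue_norm \<Omega> p (indicat_real ?E)"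
    by (simp only: superlevel_norm_def superlevel_truncated_power[OF assms])
  show "superlevel_norm \<Omega> p (truncated_power e) u \<le> ennreal (K * r powr (n / P))"
    unfolding norm_eq using r_pos by (intro var_Lebesgue_norm_indicator_le) auto
  show "superlevel_norm \<Omega> p (truncated_power e) u \<le> ennreal (K / u)"
    if "r powr (- (n / P)) \<le> u"
  proof -
    have "u powr (- (P / n)) \<le> r"
      using that less_powr_iff[OF assms(1) r_pos] by linarith
    then have "var_Lebesgue_norm \<Omega> p (indicat_real ?E)
        \<le> ennreal (K * (u powr (- (P / n))) powr (n / P))"
      using assms by (intro var_Lebesgue_norm_indicator_le) auto
    also have "(u powr (- (P / n))) powr (n / P) = 1 / u"
    proof -
      have "- (P / n) * (n / P) = - 1" using n_pos P_pos by simp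
      then show ?thesis
        using assms by (simp only: powr_powr) (simp add: powr_minus_divide)
    qed
    finally show ?thesis by (simp add: norm_eq)
  qed
  show "superlevel_norm \<Omega> p (truncated_power e) u = 0" if "e powr (- (n / P)) \<le> u"
  proof -
    have "\<not> e < u powr (- (P / n))"
      using that less_powr_iff[OF assms] by linarith
    then have "indicat_real ?E = (\<lambda>x. 0)"
      by (auto simp: indicator_def)
    then show ?thesis
      by (simp only: norm_eq var_Lebesgue_norm_zero)
  qed
qed

lemma var_Lorentz_norm_infinity_le:
  assumes e: "0 < e"
  shows "var_Lorentz_norm \<Omega> p \<infinity> (truncated_power e) \<le> ennreal K"
proof -
  have "ennreal u * superlevel_norm \<Omega> p (truncated_power e) u \<le> ennreal K" if u: "0 < u" for u
  proof -
    have "superlevel_norm \<Omega> p (truncated_power e) u \<le> ennreal (K / u)"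
    proof (cases "r powr (- (n / P)) \<le> u")
      \<comment> \<open>At these low levels the bound from the whole ball is already at most
        \<open>K / u\<close>.\<close>
      case False
      then have "u * r powr (n / P) \<le> 1"
        using r_pos by (simp add: powr_minus_divide field_simps)
      then have "K * r powr (n / P) \<le> K / u"
        using u K_ge_1 by (simp add: field_simps)
      then show ?thesis
        using superlevel_norm_le(1)[OF u e] by (meson ennreal_leI order_trans)
    qed (use superlevel_norm_le(2)[OF u e] in auto)
    then have "ennreal u * superlevel_norm \<Omega> p (truncated_power e) u
        \<le> ennreal u * ennreal (K / u)"
      by (rule mult_left_mono) simp
    also have "\<dots> = ennreal K"
      using u K_ge_1 by (simp flip: ennreal_mult)
    finally show ?thesis .
  qed
  then show ?thesis
    by (auto simp: var_Lorentz_norm_def intro!: SUP_least)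
qed

text \<open>\<open>A\<close> and \<open>M\<close> are the levels at which the estimates of
  \<open>superlevel_norm_le\<close> change. Up to the factor \<open>K powr q\<close>, levels below
  \<open>A\<close> contribute at most 1, those between \<open>A\<close> and \<open>M\<close>
  contribute at most \<open>ln (M / A)\<close>, and those above contribute nothing.\<close>

lemma var_Lorentz_norm_le:
  assumes e: "0 < e" "e \<le> r" and q: "1 < q"
  shows "var_Lorentz_norm \<Omega> p (ereal q) (truncated_power e)
    \<le> ennreal (K * (1 + n / P * ln (r / e)) powr (1 / q))"
proof -
  define A where "A = r powr (- (n / P))"
  define M where "M = e powr (- (n / P))"
  let ?N = "superlevel_norm \<Omega> p (truncated_power e)"
  have A: "0 < A" and AM: "A \<le> M"
    using r_pos e P_pos n_pos by (auto simp: A_def M_def intro!: powr_mono2')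
  have ln_MA: "ln (M / A) = n / P * ln (r / e)"
    using r_pos e by (simp add: A_def M_def ln_div ln_powr algebra_simps)
  let ?w = "\<lambda>u. ennreal (1 / A) * indicator {0..A} u + ennreal (1 / u) * indicator {A..M} u"
  have bound: "ennreal (u powr q) * ?N u epowr q / ennreal u \<le> ennreal (u powr q * y powr q / u)"
    if "0 < u" "0 \<le> y" "?N u \<le> ennreal y" for u y
  proof -
    have "?N u epowr q \<le> ennreal (y powr q)"
      using epowr_mono[OF that(3), of q] q that by (simp add: epowr_ennreal)
    then have "ennreal (u powr q) * ?N u epowr q / ennreal u
        \<le> ennreal (u powr q) * ennreal (y powr q) / ennreal u"
      by (intro divide_right_mono_ennreal mult_left_mono) auto
    then show ?thesis
      using that by (simp add: divide_ennreal flip: ennreal_mult)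
  qed
  have integrand: "ennreal (u powr q) * ?N u epowr q / ennreal u \<le> ennreal (K powr q) * ?w u"
    if u: "0 < u" for u
  proof -
    consider "u < A" | "A \<le> u" "u \<le> M" | "M \<le> u" by linarith
    then show ?thesis
    proof cases
      case 1
      have "?N u \<le> ennreal (K / A)"
        using superlevel_norm_le(1)[OF u e(1)] r_pos by (simp add: A_def powr_minus_divide)
      then have "ennreal (u powr q) * ?N u epowr q / ennreal u
          \<le> ennreal (u powr q * (K / A) powr q / u)"
        using A K_ge_1 u by (intro bound) auto
      also have "u powr q * (K / A) powr q / u = K powr q * (u powr (q - 1) / A powr q)"
        using A K_ge_1 u by (simp add: powr_divide powr_diff mult_ac)
      \<comment> \<open>Here \<open>1 < q\<close> enters: \<open>u powr (q - 1)\<close> is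
        increasing, so its value at \<open>A\<close> bounds it and the low levels stay integrable
        near 0.\<close>
      also have "\<dots> \<le> K powr q * (A powr (q - 1) / A powr q)"
        using 1 u q by (intro mult_left_mono divide_right_mono powr_mono2) auto
      also have "A powr (q - 1) / A powr q = 1 / A"
        using A by (simp add: powr_diff)
      finally show ?thesis
        using 1 u by (simp add: ennreal_leI flip: ennreal_mult)
    next
      case 2
      have "ennreal (u powr q) * ?N u epowr q / ennreal u
          \<le> ennreal (u powr q * (K / u) powr q / u)"
        using superlevel_norm_le(2)[OF u e(1)] 2 K_ge_1 u by (intro bound) (auto simp: A_def)
      also have "u powr q * (K / u) powr q / u = K powr q * (1 / u)"
        using K_ge_1 u by (simp add: powr_divide)
      also have "ennreal (K powr q * (1 / u)) = ennreal (K powr q) * ennreal (1 / u)"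
        using u by (intro ennreal_mult) auto
      also have "\<dots> \<le> ennreal (K powr q) * ?w u"
        using 2 by (intro mult_left_mono) (auto simp: indicator_def)
      finally show ?thesis .
    next
      case 3
      then have "?N u = 0" using superlevel_norm_le(3)[OF u e(1)] by (simp add: M_def)
      then show ?thesis using q by (simp add: ennpowr_def)
    qed
  qed
  have "(\<integral>\<^sup>+u\<in>{0<..}. (ennreal (u powr q) * ?N u epowr q / ennreal u) \<partial>lborel)
      \<le> (\<integral>\<^sup>+u. ennreal (K powr q) * ?w u \<partial>lborel)"
    using integrand by (intro nn_integral_mono) (auto simp: indicator_def)
  also have "\<dots> = ennreal (K powr q) * (ennreal (1 / A) * ennreal A + ennreal (ln (M / A)))"
    using A AM by (simp add: nn_integral_cmult nn_integral_add nn_integral_cmult_indicator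
        nn_integral_inverse_Icc)
  also have "ennreal (1 / A) * ennreal A + ennreal (ln (M / A)) = ennreal (1 + ln (M / A))"
  proof -
    have "ennreal (1 / A) * ennreal A = 1"
      using A by (simp flip: ennreal_mult)
    moreover have "0 \<le> ln (M / A)"
      using A AM by simp
    ultimately show ?thesis
      by simp
  qed
  also have "ennreal (K powr q) * \<dots> = ennreal (K powr q * (1 + ln (M / A)))"
    using A AM by (intro ennreal_mult[symmetric]) auto
  finally have "(\<integral>\<^sup>+u\<in>{0<..}. (ennreal (u powr q) * ?N u epowr q / ennreal u) \<partial>lborel) epowr (1 / q)
      \<le> ennreal (K powr q * (1 + ln (M / A))) epowr (1 / q)"
    using q by (intro epowr_mono) auto
  also have "\<dots> = ennreal (K * (1 + ln (M / A)) powr (1 / q))"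
    using A AM K_ge_1 q by (simp add: epowr_ennreal powr_mult powr_powr)
  finally show ?thesis
    by (simp add: var_Lorentz_norm_def ln_MA)
qed

section \<open>Lower bounds in the classical Lorentz space\<close>

text \<open>The ball around \<open>x0\<close> of measure \<open>t\<close> has a radius
  \<open>h\<close> with \<open>e \<le> h < r\<close>. At a level below
  \<open>h powr (- (n / P))\<close> the superlevel set would contain a strictly larger ball, so its
  measure would exceed \<open>t\<close>.\<close>

lemma decr_rearr_ge:
  assumes e: "0 < e" and t: "V * e powr n \<le> t" "t < V * r powr n"
  shows "ennreal ((t / V) powr (- (1 / P))) \<le> decr_rearr \<Omega> (truncated_power e) t"
proof -
  define h where "h = (t / V) powr (1 / n)"
  have "0 < V * e powr n" using e V_pos by simp
  with t(1) have t_pos: "0 < t" by linarith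
  have h_pos: "0 < h" using t_pos V_pos by (simp add: h_def)
  have h_n: "V * h powr n = t"
    using t_pos V_neq_0 n_pos by (simp add: h_def powr_powr)
  have h_P: "(t / V) powr (- (1 / P)) = h powr (- (n / P))"
    using n_pos by (simp add: h_def powr_powr)
  have "e \<le> h"
  proof (rule ccontr)
    assume "\<not> e \<le> h"
    then have "h powr n < e powr n" using h_pos n_pos by (intro powr_less_mono2) auto
    then have "V * h powr n < V * e powr n" using V_pos by simp
    with t(1) h_n show False by simp
  qed
  have "h < r"
  proof (rule ccontr)
    assume "\<not> h < r"
    then have "r powr n \<le> h powr n" using r_pos n_pos by (intro powr_mono2) auto
    then have "V * r powr n \<le> V * h powr n" using V_pos by simp
    with t(2) h_n show False by simp
  qed
  have "h powr (- (n / P)) \<le> \<sigma>"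
    if \<sigma>: "0 < \<sigma>" and small: "emeasure lebesgue {x \<in> \<Omega>. \<sigma> < \<bar>truncated_power e x\<bar>} \<le> ennreal t" for \<sigma>
  proof (rule ccontr)
    assume "\<not> h powr (- (n / P)) \<le> \<sigma>"
    then have less: "h < \<sigma> powr (- (P / n))"
      using less_powr_iff[OF \<sigma> h_pos] by simp
    \<comment> \<open>The cap at \<open>r\<close> keeps the ball inside the support;
      \<open>h < r\<close> ensures that \<open>k\<close> still exceeds \<open>h\<close>.\<close>
    define k where "k = min r (\<sigma> powr (- (P / n)))"
    have k: "h < k" using less \<open>h < r\<close> by (simp add: k_def)
    have "ennreal (V * k powr n) = emeasure lebesgue (ball x0 k)"
      using k h_pos by (simp add: emeasure_ball_powr)
    also have "\<dots> \<le> emeasure lebesgue {x \<in> \<Omega>. \<sigma> < \<bar>truncated_power e x\<bar>}"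
      unfolding superlevel_truncated_power[OF \<sigma> e]
    proof (rule emeasure_mono)
      show "ball x0 k \<subseteq> {x \<in> ball x0 r. max (dist x0 x) e < \<sigma> powr (- (P / n))}"
        using less \<open>e \<le> h\<close> by (auto simp: k_def)
      \<comment> \<open>Monotonicity of the measure requires the larger set to be measurable, which
        holds because it is a ball or empty.\<close>
      have "{x \<in> ball x0 r. max (dist x0 x) e < \<sigma> powr (- (P / n))} =
          (if e < \<sigma> powr (- (P / n)) then ball x0 k else {})"
        by (auto simp: k_def)
      then show "{x \<in> ball x0 r. max (dist x0 x) e < \<sigma> powr (- (P / n))} \<in> sets lebesgue"
        by simp
    qed
    also note small
    finally have "V * k powr n \<le> V * h powr n"
      using t_pos h_n by simp
    then have "k powr n \<le> h powr n" using V_pos by simp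
    moreover have "h powr n < k powr n" using k h_pos n_pos by (intro powr_less_mono2) auto
    ultimately show False by simp
  qed
  then show ?thesis
    unfolding decr_rearr_def h_P by (intro Inf_greatest) (auto intro!: ennreal_leI)
qed

text \<open>Between the measures \<open>a\<close> and \<open>b\<close> of the balls of radius
  \<open>e\<close> and \<open>r\<close>, the weighted rearrangement is at least the constant
  \<open>V powr (1 / P)\<close>, so the integrand is at least a multiple of
  \<open>1 / t\<close>.\<close>

lemma Lorentz_norm_ge:
  assumes e: "0 < e" "e \<le> r" and s: "0 < s"
  shows "ennreal (V powr (1 / P) * (n * ln (r / e)) powr (1 / s))
    \<le> Lorentz_norm \<Omega> P (ereal s) (truncated_power e)"
proof -
  define a where "a = V * e powr n"
  define b where "b = V * r powr n"
  have a_pos: "0 < a" and ab: "a \<le> b"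
    using V_pos e n_pos by (auto simp: a_def b_def intro!: mult_left_mono powr_mono2)
  have ln_ba: "ln (b / a) = n * ln (r / e)"
    using V_pos e r_pos by (simp add: a_def b_def ln_div ln_powr ln_mult algebra_simps)
  let ?I = "\<lambda>t. (ennreal (t powr (1 / P)) * decr_rearr \<Omega> (truncated_power e) t) epowr s / ennreal t"
  have "ennreal (V powr (s / P) * ln (b / a))
      = ennreal (V powr (s / P)) * (\<integral>\<^sup>+t\<in>{a..b}. ennreal (1 / t) \<partial>lborel)"
    using a_pos ab by (simp add: nn_integral_inverse_Icc ennreal_mult)
  also have "\<dots> = (\<integral>\<^sup>+t\<in>{a..b}. (ennreal (V powr (s / P)) * ennreal (1 / t)) \<partial>lborel)"
    by (simp add: mult.assoc flip: nn_integral_cmult)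
  also have "\<dots> \<le> (\<integral>\<^sup>+t\<in>{0<..}. ?I t \<partial>lborel)"
  proof (rule nn_integral_mono_AE)
    show "AE t in lborel. ennreal (V powr (s / P)) * ennreal (1 / t) * indicator {a..b} t
        \<le> ?I t * indicator {0<..} t"
      \<comment> \<open>The endpoint \<open>b\<close> is dropped as a null set because
        \<open>decr_rearr_ge\<close> requires \<open>t\<close> strictly below it.\<close>
      using AE_lborel_singleton[of b]
    proof eventually_elim
      case (elim t)
      show ?case
      proof (cases "t \<in> {a..b}")
        case True
        with elim a_pos have t: "0 < t" "a \<le> t" "t < b" by auto
        have "ennreal (V powr (1 / P)) = ennreal (t powr (1 / P)) * ennreal ((t / V) powr (- (1 / P)))"
          using t V_pos by (simp add: powr_divide powr_minus field_simps flip: ennreal_mult)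
        also have "\<dots> \<le> ennreal (t powr (1 / P)) * decr_rearr \<Omega> (truncated_power e) t"
          using t e by (intro mult_left_mono decr_rearr_ge) (auto simp: a_def b_def)
        finally have "ennreal (V powr (1 / P)) epowr s
            \<le> (ennreal (t powr (1 / P)) * decr_rearr \<Omega> (truncated_power e) t) epowr s"
          using s by (intro epowr_mono)
        then have "ennreal (V powr (s / P)) / ennreal t \<le> ?I t"
          by (intro divide_right_mono_ennreal) (simp add: epowr_ennreal powr_powr)
        then show ?thesis
          using t True by (simp add: divide_ennreal flip: ennreal_mult)
      qed simp
    qed
  qed
  finally have "ennreal (V powr (s / P) * ln (b / a)) epowr (1 / s)
      \<le> (\<integral>\<^sup>+t\<in>{0<..}. ?I t \<partial>lborel) epowr (1 / s)"
    using s by (intro epowr_mono) auto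
  moreover have "ennreal (V powr (s / P) * ln (b / a)) epowr (1 / s)
      = ennreal (V powr (1 / P) * ln (b / a) powr (1 / s))"
    using a_pos ab s by (simp add: epowr_ennreal powr_mult powr_powr)
  ultimately show ?thesis
    by (simp add: Lorentz_norm_def ln_ba)
qed

section \<open>Variable Lebesgue upper bound\<close>

lemma nn_integral_truncated_power_le:
  "(\<integral>\<^sup>+x\<in>ball x0 r. ennreal (max (dist x0 x) (r / 2 ^ N) powr (- n)) \<partial>lborel)
    \<le> ennreal (2 powr n * V * (real N + 1))"
proof -
  txt \<open>Dyadic shells replace integration in polar coordinates.\<close>
  have shell: "\<exists>k\<le>N. d < r / 2 ^ k \<and> r / 2 ^ Suc k \<le> max d (r / 2 ^ N)" if "d < r" for d N
  proof (induction N)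
    case 0
    show ?case using that r_pos by simp
  next
    case (Suc N)
    show ?case
    proof (cases "d < r / 2 ^ Suc N")
      case True
      moreover have "r / 2 ^ Suc (Suc N) \<le> r / 2 ^ Suc N"
        using r_pos by (simp add: field_simps)
      ultimately show ?thesis by (intro exI[of _ "Suc N"]) auto
    next
      case False
      show ?thesis
      proof (cases "d < r / 2 ^ N")
        case True
        then show ?thesis using False by (intro exI[of _ N]) auto
      next
        case False
        with Suc obtain k where "k \<le> N" "d < r / 2 ^ k" "r / 2 ^ Suc k \<le> d"
          by (auto simp: max_def split: if_splits)
        then show ?thesis by (intro exI[of _ k]) auto
      qed
    qed
  qed
  \<comment> \<open>Each shell is enlarged to the full ball of its outer radius and the integrand to
    its value at the inner radius. By scaling every term then integrates to the same constant
    \<open>2 powr n * V\<close>.\<close>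
  let ?s = "\<lambda>k x. ennreal ((r / 2 ^ Suc k) powr (- n)) * indicator (ball x0 (r / 2 ^ k)) x"
  have "(\<integral>\<^sup>+x\<in>ball x0 r. ennreal (max (dist x0 x) (r / 2 ^ N) powr (- n)) \<partial>lborel)
      \<le> (\<integral>\<^sup>+x. (\<Sum>k\<le>N. ?s k x) \<partial>lborel)"
  proof (rule nn_integral_mono)
    fix x
    show "ennreal (max (dist x0 x) (r / 2 ^ N) powr (- n)) * indicator (ball x0 r) x \<le> (\<Sum>k\<le>N. ?s k x)"
    proof (cases "x \<in> ball x0 r")
      case True
      then have "dist x0 x < r" by simp
      from shell[OF this, of N] obtain k where k: "k \<le> N" "dist x0 x < r / 2 ^ k"
        "r / 2 ^ Suc k \<le> max (dist x0 x) (r / 2 ^ N)" by blast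
      have "max (dist x0 x) (r / 2 ^ N) powr (- n) \<le> (r / 2 ^ Suc k) powr (- n)"
        using k(3) r_pos n_pos by (intro powr_mono2') auto
      then have "ennreal (max (dist x0 x) (r / 2 ^ N) powr (- n)) * indicator (ball x0 r) x \<le> ?s k x"
        using k(2) True by (simp add: ennreal_leI)
      also have "\<dots> \<le> (\<Sum>k\<le>N. ?s k x)"
        using k(1) by (intro member_le_sum) auto
      finally show ?thesis .
    qed simp
  qed
  also have "\<dots> = (\<Sum>k\<le>N. \<integral>\<^sup>+x. ?s k x \<partial>lborel)"
    by (intro nn_integral_sum borel_measurable_times_ennreal borel_measurable_const
        borel_measurable_indicator) simp
  also have "\<dots> = (\<Sum>k\<le>N. ennreal (2 powr n * V))"
  proof (rule sum.cong)
    fix k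
    have "(\<integral>\<^sup>+x. ?s k x \<partial>lborel)
        = ennreal ((r / 2 ^ Suc k) powr (- n)) * ennreal (V * (r / 2 ^ k) powr n)"
      using r_pos by (simp add: nn_integral_cmult_indicator emeasure_ball_powr)
    also have "\<dots> = ennreal ((r / 2 ^ Suc k) powr (- n) * (V * (r / 2 ^ k) powr n))"
      using V_pos by (intro ennreal_mult[symmetric]) auto
    also have "(r / 2 ^ Suc k) powr (- n) * (V * (r / 2 ^ k) powr n) = 2 powr n * V"
    proof -
      have "(r / 2 ^ Suc k) powr (- n) = ((r / 2 ^ k) / 2) powr (- n)"
        by (simp add: mult.commute)
      also have "\<dots> = (r / 2 ^ k) powr (- n) / 2 powr (- n)"
        by (rule powr_divide)
      also have "\<dots> = (r / 2 ^ k) powr (- n) * 2 powr n"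
        by (simp only: powr_minus[of 2 n] divide_inverse inverse_inverse_eq)
      finally have "(r / 2 ^ Suc k) powr (- n) * (V * (r / 2 ^ k) powr n)
          = (r / 2 ^ k) powr (- n) * 2 powr n * (V * (r / 2 ^ k) powr n)"
        by (rule arg_cong)
      also have "\<dots> = 2 powr n * V"
        using r_pos by (simp add: powr_minus)
      finally show ?thesis .
    qed
    finally show "(\<integral>\<^sup>+x. ?s k x \<partial>lborel) = ennreal (2 powr n * V)" .
  qed simp
  also have "\<dots> = ennreal (2 powr n * V * (real N + 1))"
  proof -
    have "(\<Sum>k\<le>N. ennreal (2 powr n * V)) = ennreal (\<Sum>k\<le>N. 2 powr n * V)"
      using V_pos by (intro sum_ennreal) simp
    also have "(\<Sum>k\<le>N. 2 powr n * V) = 2 powr n * V * (real N + 1)"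
      by simp
    finally show ?thesis .
  qed
  finally show ?thesis .
qed

text \<open>Freezing the exponent leaves \<open>l powr (- P) * D\<close> times the dyadic integral,
  which is linear in \<open>N\<close>; the hypothesis \<open>le\<close> lets \<open>l powr P\<close>
  absorb it.\<close>

lemma modular_truncated_power_le:
  assumes l: "1 \<le> l" and le: "D * 2 powr n * V * (real N + 1) \<le> l powr P"
  shows "modular \<Omega> p (\<lambda>x. truncated_power (r / 2 ^ N) x / l) \<le> 1"
proof -
  let ?h = "\<lambda>x. max (dist x0 x) (r / 2 ^ N)"
  have "r / 2 ^ N \<le> r" using r_pos by (simp add: field_simps)
  then have "modular \<Omega> p (\<lambda>x. truncated_power (r / 2 ^ N) x / l)
      \<le> (\<integral>\<^sup>+x\<in>ball x0 r. ennreal (l powr (- P) * D * ?h x powr (- n)) \<partial>lborel)"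
    using l r_pos
    by (intro modular_le)
      (auto simp: truncated_power_def indicator_def max_less_iff_conj less_max_iff_disj split: if_splits)
  also have "\<dots> = ennreal (l powr (- P) * D) *
      (\<integral>\<^sup>+x\<in>ball x0 r. ennreal (?h x powr (- n)) \<partial>lborel)"
  proof -
    have "(\<lambda>x. ennreal (?h x powr (- n)) * indicator (ball x0 r) x) \<in> borel_measurable lborel"
      by (intro borel_measurable_times_ennreal borel_measurable_indicator
          measurable_compose[OF _ measurable_ennreal] powr_real_measurable
          borel_measurable_max borel_measurable_const borel_measurable_dist) auto
    from nn_integral_cmult[OF this, of "ennreal (l powr (- P) * D)"] show ?thesis
      by (simp add: ennreal_mult mult.assoc)
  qed
  also have "\<dots> \<le> ennreal (l powr (- P) * D) * ennreal (2 powr n * V * (real N + 1))"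
    by (intro mult_left_mono nn_integral_truncated_power_le) simp
  also have "\<dots> = ennreal (l powr (- P) * D * (2 powr n * V * (real N + 1)))"
    using V_pos by (intro ennreal_mult[symmetric]) auto
  also have "\<dots> \<le> ennreal (l powr (- P) * l powr P)"
    unfolding mult.assoc using le by (intro ennreal_leI mult_left_mono) (auto simp: mult.assoc)
  also have "\<dots> = 1"
    using l by (simp add: powr_minus)
  finally show ?thesis .
qed

section \<open>Failure of the embeddings along dyadic truncations\<close>

text \<open>Truncating at \<open>r / 2 ^ N\<close> makes \<open>ln (r / e)\<close> equal to
  \<open>N * ln 2\<close>, so logarithmic growth becomes the power growth of the criterion.\<close>

lemma Lorentz_norm_dyadic_ge:
  assumes "0 < s"
  shows "ennreal (V powr (1 / P) * (n * ln 2) powr (1 / s) * real N powr (1 / s))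
    \<le> Lorentz_norm \<Omega> P (ereal s) (truncated_power (r / 2 ^ N))"
proof -
  have "ln (r / (r / 2 ^ N)) = real N * ln 2"
    using r_pos by (simp add: ln_realpow)
  moreover have "(n * (real N * ln 2)) powr (1 / s) = (n * ln 2) powr (1 / s) * real N powr (1 / s)"
    using n_pos by (simp add: mult_ac flip: powr_mult)
  ultimately show ?thesis
    using Lorentz_norm_ge[of "r / 2 ^ N" s] assms r_pos by (simp add: field_simps)
qed

lemma var_Lebesgue_not_embedded:
  assumes s: "0 < s" "s < P"
  shows "var_Lebesgue \<Omega> p \<not>\<hookrightarrow> Lorentz \<Omega> P (ereal s)"
proof -
  \<comment> \<open>The factor 2 absorbs \<open>N + 1 \<le> 2 * N\<close>; the maximum with 1 keeps
    the divisor \<open>(b * real N) powr (1 / P)\<close> at least 1.\<close>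
  define b where "b = max 1 (2 * (D * 2 powr n * V))"
  have modular_le_1: "modular \<Omega> p (\<lambda>x. truncated_power (r / 2 ^ N) x / (b * real N) powr (1 / P)) \<le> 1"
    if N: "1 \<le> N" for N
  proof (rule modular_truncated_power_le)
    have "1 * 1 \<le> b * real N"
      using N by (intro mult_mono) (auto simp: b_def)
    then show "1 \<le> (b * real N) powr (1 / P)"
      using P_pos by (intro ge_one_powr_ge_zero) auto
    have "D * 2 powr n * V * (real N + 1) \<le> D * 2 powr n * V * (2 * real N)"
      using N V_pos by (intro mult_left_mono) auto
    also have "\<dots> = 2 * (D * 2 powr n * V) * real N"
      by (simp only: mult_ac)
    also have "\<dots> \<le> b * real N"
      by (intro mult_right_mono) (auto simp: b_def)
    also have "\<dots> = ((b * real N) powr (1 / P)) powr P"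
      using P_pos by (simp add: powr_powr b_def)
    finally show "D * 2 powr n * V * (real N + 1) \<le> ((b * real N) powr (1 / P)) powr P" .
  qed
  have b_pos: "0 < b" by (simp add: b_def)
  show ?thesis
  proof (rule not_cont_embedded_if_growth)
    show "1 / P < 1 / s" using s P_pos by (simp add: field_simps)
    show "0 < V powr (1 / P) * (n * ln 2) powr (1 / s)" using V_neq_0 n_pos by simp
    fix N :: nat
    assume N: "1 \<le> N"
    have l: "0 < (b * real N) powr (1 / P)" using N b_pos by simp
    show "truncated_power (r / 2 ^ N) \<in> fst (var_Lebesgue \<Omega> p)"
      using modular_le_1[OF N] l truncated_power_measurable
      by (auto simp: var_Lebesgue_def intro!: exI[of _ "(b * real N) powr (1 / P)"]
          elim: order.strict_trans1)
    show "snd (var_Lebesgue \<Omega> p) (truncated_power (r / 2 ^ N))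
        \<le> ennreal (b powr (1 / P) * real N powr (1 / P))"
      using var_Lebesgue_norm_le[OF l modular_le_1[OF N]] b_pos
      by (simp add: var_Lebesgue_def powr_mult)
    show "ennreal (V powr (1 / P) * (n * ln 2) powr (1 / s) * real N powr (1 / s))
        \<le> snd (Lorentz \<Omega> P (ereal s)) (truncated_power (r / 2 ^ N))"
      using Lorentz_norm_dyadic_ge s by (simp add: Lorentz_def)
  qed
qed

lemma var_Lorentz_not_embedded:
  assumes q: "1 < q" and u: "0 < u" "ereal u < q"
  shows "var_Lorentz \<Omega> p q \<not>\<hookrightarrow> Lorentz \<Omega> P (ereal u)"
proof -
  \<comment> \<open>The growth exponent \<open>\<alpha>\<close> is \<open>1 / q\<close> for finite
    \<open>q\<close> and 0 for \<open>q = \<infinity>\<close>, where the norms stay bounded.\<close>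
  obtain \<alpha> b where \<alpha>: "\<alpha> < 1 / u"
    and upper: "\<And>N. 1 \<le> N \<Longrightarrow>
      var_Lorentz_norm \<Omega> p q (truncated_power (r / 2 ^ N)) \<le> ennreal (b * real N powr \<alpha>)"
  proof (cases q)
    case (real q')
    with q u have q': "1 < q'" "u < q'" by auto
    show thesis
    proof (rule that[of "1 / q'" "K * (1 + n / P * ln 2) powr (1 / q')"])
      show "1 / q' < 1 / u" using q' u by (simp add: field_simps)
      fix N :: nat
      assume N: "1 \<le> N"
      have "ln (r / (r / 2 ^ N)) = real N * ln 2"
        using r_pos by (simp add: ln_realpow)
      then have "var_Lorentz_norm \<Omega> p q (truncated_power (r / 2 ^ N))
          \<le> ennreal (K * (1 + n / P * (real N * ln 2)) powr (1 / q'))"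
        using var_Lorentz_norm_le[of "r / 2 ^ N" q'] q' r_pos real by (simp add: field_simps)
      \<comment> \<open>The additive 1 is absorbed using \<open>1 \<le> N\<close>.\<close>
      also have "\<dots> \<le> ennreal (K * ((1 + n / P * ln 2) * real N) powr (1 / q'))"
        using N q' K_ge_1 n_pos P_pos
        by (intro ennreal_leI mult_left_mono powr_mono2) (auto simp: algebra_simps intro!: add_nonneg_nonneg)
      also have "\<dots> = ennreal (K * (1 + n / P * ln 2) powr (1 / q') * real N powr (1 / q'))"
        using n_pos P_pos by (simp add: powr_mult mult.assoc)
      finally show "var_Lorentz_norm \<Omega> p q (truncated_power (r / 2 ^ N)) \<le> \<dots>" .
    qed
  next
    case PInf
    show thesis
    proof (rule that[of 0 K])
      show "0 < 1 / u" using u by simp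
      fix N :: nat
      assume "1 \<le> N"
      then show "var_Lorentz_norm \<Omega> p q (truncated_power (r / 2 ^ N)) \<le> ennreal (K * real N powr 0)"
        using var_Lorentz_norm_infinity_le[of "r / 2 ^ N"] r_pos PInf by simp
    qed
  qed (use q in auto)
  show ?thesis
  proof (rule not_cont_embedded_if_growth)
    show "\<alpha> < 1 / u" by (rule \<alpha>)
    show "0 < V powr (1 / P) * (n * ln 2) powr (1 / u)" using V_neq_0 n_pos by simp
    fix N :: nat
    assume N: "1 \<le> N"
    have "var_Lorentz_norm \<Omega> p q (truncated_power (r / 2 ^ N)) < \<infinity>"
      using upper[OF N] by (rule order.strict_trans1) simp
    then show "truncated_power (r / 2 ^ N) \<in> fst (var_Lorentz \<Omega> p q)"
      using truncated_power_measurable by (simp add: var_Lorentz_def)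
    show "snd (var_Lorentz \<Omega> p q) (truncated_power (r / 2 ^ N)) \<le> ennreal (b * real N powr \<alpha>)"
      using upper[OF N] by (simp add: var_Lorentz_def)
    show "ennreal (V powr (1 / P) * (n * ln 2) powr (1 / u) * real N powr (1 / u))
        \<le> snd (Lorentz \<Omega> P (ereal u)) (truncated_power (r / 2 ^ N))"
      using Lorentz_norm_dyadic_ge u by (simp add: Lorentz_def)
  qed
qed

end

section \<open>Reduction to the local setting\<close>

theorem corollary7p8:
  fixes \<Omega> :: "'a::euclidean_space set" and p :: "'a \<Rightarrow> real" and x0 :: 'a
  assumes "open \<Omega>" and "emeasure lebesgue \<Omega> < \<infinity>"
    and "p \<in> exponent_functions \<Omega>" and "p_plus \<Omega> p < \<infinity>"
    and "x0 \<in> \<Omega>" and "ereal (p x0) = p_minus \<Omega> p" and "p \<in> log_hoelder_at \<Omega> x0"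
  shows "(1 < p_minus \<Omega> p \<longrightarrow>
            (\<forall>s. 0 < s \<and> s < p_minus \<Omega> p \<longrightarrow>
               var_Lebesgue \<Omega> p \<not>\<hookrightarrow> Lorentz \<Omega> (real_of_ereal (p_minus \<Omega> p)) s))
       \<and> (\<forall>q. 1 < q \<and> q \<le> \<infinity> \<longrightarrow>
            (\<forall>u. 0 < u \<and> u < q \<longrightarrow>
               var_Lorentz \<Omega> p q \<not>\<hookrightarrow> Lorentz \<Omega> (real_of_ereal (p_minus \<Omega> p)) u))"
proof -
  define P where "P = p x0"
  have p_minus: "p_minus \<Omega> p = ereal P"
    using assms(6) by (simp add: P_def)
  obtain C where C: "0 < C"
    "\<And>x. x \<in> \<Omega> \<Longrightarrow> norm (x - x0) < 1 / 2 \<Longrightarrow> \<bar>p x - P\<bar> \<le> C / (- ln (norm (x - x0)))"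
    using assms(7) unfolding log_hoelder_at_def P_def by blast
  obtain \<delta> where \<delta>: "0 < \<delta>" "ball x0 \<delta> \<subseteq> \<Omega>"
    using assms(1,5) open_contains_ball by blast
  \<comment> \<open>The ball must lie in the domain and inside the range
    \<open>norm (x - x0) < 1 / 2\<close> of the Hoelder bound; \<open>1 / 4\<close> also gives the
    strict inequality \<open>r < 1 / 2\<close>.\<close>
  define r where "r = min \<delta> (1 / 4)"
  have ball: "ball x0 r \<subseteq> \<Omega>"
    using \<delta> by (auto simp: r_def)
  interpret log_hoelder_minimum \<Omega> p x0 P r C "real DIM('a)"
  proof
    show "0 < P" using assms(3,5) by (simp add: P_def exponent_functions_def)
    show "AE x in lebesgue_on \<Omega>. P \<le> p x"
      using AE_essinf_le[OF p_minus[unfolded p_minus_def]] by simp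
    show "p x - P \<le> C / (- ln (dist x0 x))" if "x \<in> ball x0 r" for x
    proof -
      have "norm (x - x0) < 1 / 2" "x \<in> \<Omega>"
        using that ball by (auto simp: r_def dist_norm norm_minus_commute)
      then show ?thesis
        using C(2)[of x] by (simp add: dist_norm norm_minus_commute)
    qed
  qed (use assms(1) C(1) \<delta> ball in \<open>auto simp: r_def\<close>)
  \<comment> \<open>The bounds on \<open>s\<close> exclude infinite values, so the case split leaves
    a real index; the same holds for \<open>u\<close> below.\<close>
  have "var_Lebesgue \<Omega> p \<not>\<hookrightarrow> Lorentz \<Omega> P s" if "0 < s" "s < ereal P" for s
    using that var_Lebesgue_not_embedded by (cases s) auto
  moreover have "var_Lorentz \<Omega> p q \<not>\<hookrightarrow> Lorentz \<Omega> P u" if "1 < q" "0 < u" "u < q" for q u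
    using that var_Lorentz_not_embedded by (cases u) auto
  ultimately show ?thesis
    by (simp add: p_minus)
qed

end
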